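(* Let $X$ be a real Hilbert space, let $T\colon X\to X$ be firmly nonexpansive, let $A\colon X\rightrightarrows X$ be maximally monotone, and suppose that $T=J_A$, or equivalently that $A=T^{-1}-\mathrm{Id}$. Then the following are equivalent: (i) $T$ is strictly nonexpansive. (ii) $A$ is disjointly injective. (iii) $\mathrm{Id}-T$ is injective. (iv) $A^{-1}$ is at most single-valued. Thus, for firmly nonexpansive mappings, strict nonexpansiveness and injectivity are dual to each other; and correspondingly, for maximally monotone operators, disjoint injectivity and at most single-valuedness are dual to each other. These properties are not self-dual: e.g., $T\equiv0$ is strictly nonexpansive, but $\mathrm{Id}-T=\mathrm{Id}$ is not; correspondingly, $A=\partial\iota_{\{0\}}$ is disjointly injective but $A^{-1}=0$ is not.
   Context: $X$ is a real Hilbert space; $\mathrm{Id}$ is the identity on $X$. $T\colon X\to X$ is firmly nonexpansive if $\|Tx-Ty\|^2+\|(\mathrm{Id}-T)x-(\mathrm{Id}-T)y\|^2\leq\|x-y\|^2$ for all $x,y\in X$; it is strictly nonexpansive if $x\neq y\Rightarrow\|Tx-Ty\|<\|x-y\|$ for all $x,y\in X$. For $A\colon X\rightrightarrows X$ (so $Ax\subseteq X$ for each $x$): $\operatorname{gr}A=\{(x,u):u\in Ax\}$ and $x\in A^{-1}u\Leftrightarrow u\in Ax$. $A$ is at most single-valued if each $Ax$ has at most one element; $A$ is disjointly injective if $x\neq y\Rightarrow Ax\cap Ay=\varnothing$ for all $x,y\in X$. $A$ is monotone if $\langle x-y,u-v\rangle\geq0$ for all $(x,u),(y,v)\in\operatorname{gr}A$,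 and maximally monotone if it is monotone and has no proper monotone extension. The resolvent of a maximally monotone $A$ is $J_A=(\mathrm{Id}+A)^{-1}\colon X\to X$. $\partial\iota_{\{0\}}$ is the subdifferential of the indicator function of $\{0\}$, i.e., the operator with graph $\{0\}\times X$. Properties $(p),(p^* )$ of firmly nonexpansive mappings on $X$ are dual to each other if, for every firmly nonexpansive $T\colon X\to X$, $T$ satisfies $(p)$ if and only if $\mathrm{Id}-T$ satisfies $(p^* )$. Properties $(q),(q^* )$ of maximally monotone operators on $X$ are dual to each other if, for every maximally monotone $A\colon X\rightrightarrows X$, $A$ satisfies $(q)$ if and only if $A^{-1}$ satisfies $(q^* )$. A property is self-dual if it is dual to itself. *)

theory Defs
  imports "HOL-Analysis.Analysis"
begin

text \<open>
  A real Hilbert space is a type of sort \<open>{real_inner, complete_space}\<close>; this sort includes the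
  zero space. A set-valued operator is a function of type \<open>'a \<Rightarrow> 'a set\<close>, and \<open>Id - T\<close> is written
  \<open>\<lambda>x. x - T x\<close>.
\<close>

definition firmly_nonexpansive :: "('a::real_inner \<Rightarrow> 'a) \<Rightarrow> bool" where
  "firmly_nonexpansive T \<longleftrightarrow>
     (\<forall>x y. (norm (T x - T y))\<^sup>2 + (norm ((x - T x) - (y - T y)))\<^sup>2 \<le> (norm (x - y))\<^sup>2)"

definition strictly_nonexpansive :: "('a::real_inner \<Rightarrow> 'a) \<Rightarrow> bool" where
  "strictly_nonexpansive T \<longleftrightarrow> (\<forall>x y. x \<noteq> y \<longrightarrow> norm (T x - T y) < norm (x - y))"

definition gr :: "('a \<Rightarrow> 'b set) \<Rightarrow> ('a \<times> 'b) set" where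
  "gr A = {(x, u). u \<in> A x}"

definition op_of :: "('a \<Rightarrow> 'b) \<Rightarrow> 'a \<Rightarrow> 'b set" where
  "op_of T = (\<lambda>x. {T x})"

definition op_inverse :: "('a \<Rightarrow> 'b set) \<Rightarrow> 'b \<Rightarrow> 'a set" where
  "op_inverse A = (\<lambda>u. {x. u \<in> A x})"

definition op_plus :: "('a \<Rightarrow> 'b::plus set) \<Rightarrow> ('a \<Rightarrow> 'b set) \<Rightarrow> 'a \<Rightarrow> 'b set" where
  "op_plus A B = (\<lambda>x. {u + v |u v. u \<in> A x \<and> v \<in> B x})"

definition op_minus :: "('a \<Rightarrow> 'b::minus set) \<Rightarrow> ('a \<Rightarrow> 'b set) \<Rightarrow> 'a \<Rightarrow> 'b set" where
  "op_minus A B = (\<lambda>x. {u - v |u v. u \<in> A x \<and> v \<in> B x})"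

definition at_most_single_valued :: "('a \<Rightarrow> 'b set) \<Rightarrow> bool" where
  "at_most_single_valued A \<longleftrightarrow> (\<forall>x. \<forall>u\<in>A x. \<forall>v\<in>A x. u = v)"

definition disjointly_injective :: "('a \<Rightarrow> 'b set) \<Rightarrow> bool" where
  "disjointly_injective A \<longleftrightarrow> (\<forall>x y. x \<noteq> y \<longrightarrow> A x \<inter> A y = {})"

definition monotone_op :: "('a::real_inner \<Rightarrow> 'a set) \<Rightarrow> bool" where
  "monotone_op A \<longleftrightarrow> (\<forall>(x, u)\<in>gr A. \<forall>(y, v)\<in>gr A. 0 \<le> inner (x - y) (u - v))"

definition maximally_monotone :: "('a::real_inner \<Rightarrow> 'a set) \<Rightarrow> bool" where
  "maximally_monotone A \<longleftrightarrow> monotone_op A \<and> (\<nexists>B. monotone_op B \<and> gr A \<subset> gr B)"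

text \<open>
  The resolvent is kept set-valued; that it is the (everywhere defined, single-valued) map \<open>T\<close> is
  expressed by \<open>op_of T = resolvent A\<close>.
\<close>
definition resolvent :: "('a::real_inner \<Rightarrow> 'a set) \<Rightarrow> 'a \<Rightarrow> 'a set" where
  "resolvent A = op_inverse (op_plus (op_of id) A)"

definition convex_indicator :: "'a set \<Rightarrow> 'a \<Rightarrow> ereal" where
  "convex_indicator C = (\<lambda>x. if x \<in> C then 0 else \<infinity>)"

definition subdifferential :: "('a::real_inner \<Rightarrow> ereal) \<Rightarrow> 'a \<Rightarrow> 'a set" where
  "subdifferential f = (\<lambda>x. {u. \<forall>y. ereal (inner (y - x) u) + f x \<le> f y})"

lemma gr_subdifferential_convex_indicator_zero:
  "gr (subdifferential (convex_indicator {0::'a::real_inner})) = {0} \<times> UNIV"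
proof -
  have "u \<in> subdifferential (convex_indicator {0}) x \<longleftrightarrow> x = 0" for x u :: 'a
    by (auto simp: subdifferential_def convex_indicator_def zero_ereal_def dest: spec[where x = 0])
  then show ?thesis
    by (auto simp: gr_def)
qed

definition dual_firmly_nonexpansive ::
  "(('a::real_inner \<Rightarrow> 'a) \<Rightarrow> bool) \<Rightarrow> (('a \<Rightarrow> 'a) \<Rightarrow> bool) \<Rightarrow> bool" where
  "dual_firmly_nonexpansive p p' \<longleftrightarrow>
     (\<forall>T. firmly_nonexpansive T \<longrightarrow> (p T \<longleftrightarrow> p' (\<lambda>x. x - T x)))"

definition dual_maximally_monotone ::
  "(('a::real_inner \<Rightarrow> 'a set) \<Rightarrow> bool) \<Rightarrow> (('a \<Rightarrow> 'a set) \<Rightarrow> bool) \<Rightarrow> bool" where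
  "dual_maximally_monotone q q' \<longleftrightarrow>
     (\<forall>A. maximally_monotone A \<longrightarrow> (q A \<longleftrightarrow> q' (op_inverse A)))"

end

(*
  For a firmly nonexpansive T, equality |Tx - Ty| = |x - y| forces (Id - T)x = (Id - T)y, so strict
  nonexpansiveness of T is exactly injectivity of Id - T. The graph of A is {(Tx, x - Tx) | x}, so two
  points whose values under A share an element u are the T-images of two points at which Id - T
  equals u; hence injectivity of Id - T is disjoint injectivity of A. For the concrete operators,
  maximality follows from the easy half of Minty's theorem: a monotone operator whose resolvent is
  everywhere defined is maximal.
*)
theory Submission
  imports Defs
begin

lemma mem_op_inverse [simp]: "x \<in> op_inverse A u \<longleftrightarrow> u \<in> A x"
  by (simp add: op_inverse_def)

lemma mem_op_of [simp]: "y \<in> op_of T x \<longleftrightarrow> y = T x"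
  by (simp add: op_of_def)

lemma mem_gr [simp]: "(x, u) \<in> gr A \<longleftrightarrow> u \<in> A x"
  by (simp add: gr_def)

lemma mem_resolvent: "y \<in> resolvent A x \<longleftrightarrow> x - y \<in> A y"
proof -
  have "(\<exists>u. x = y + u \<and> u \<in> A y) \<longleftrightarrow> x - y \<in> A y"
    by (metis add_diff_cancel_left' add_diff_cancel_left diff_add_cancel add.commute)
  then show ?thesis
    by (simp add: resolvent_def op_plus_def)
qed

text \<open>Substituting \<open>x = y + u\<close> turns the relation between \<open>T\<close> and
  \<open>A\<close> into a pointwise condition with no set-valued sums or inverses. It is the common
  normal form through which \<open>T = J_A\<close> and \<open>A = T^{-1} - Id\<close> are
  compared.\<close>

lemma op_of_eq_resolvent_iff:
  "op_of T = resolvent A \<longleftrightarrow> (\<forall>y u. u \<in> A y \<longleftrightarrow> T (y + u) = y)"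
proof -
  have "op_of T = resolvent A \<longleftrightarrow> (\<forall>x y. y = T x \<longleftrightarrow> x - y \<in> A y)"
    by (simp add: fun_eq_iff set_eq_iff mem_resolvent)
  also have "\<dots> \<longleftrightarrow> (\<forall>y u. u \<in> A y \<longleftrightarrow> T (y + u) = y)"
    by (metis add_diff_cancel_left' add.commute diff_add_cancel)
  finally show ?thesis .
qed

text \<open>An element of \<open>T^{-1} y - y\<close> is \<open>x - y\<close> with
  \<open>T x = y\<close>; writing \<open>u\<close> for it gives \<open>x = y + u\<close>, hence the
  same normal form as for the resolvent.\<close>

lemma eq_op_inverse_minus_id_iff:
  fixes A :: "'a::ab_group_add \<Rightarrow> 'a set"
  shows "A = op_minus (op_inverse (op_of T)) (op_of id) \<longleftrightarrow> (\<forall>y u. u \<in> A y \<longleftrightarrow> T (y + u) = y)"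
proof -
  have "u \<in> op_minus (op_inverse (op_of T)) (op_of id) y \<longleftrightarrow> T (y + u) = y" for y u
  proof -
    have "(\<exists>x. u = x - y \<and> y = T x) \<longleftrightarrow> T (y + u) = y"
      by (metis add_diff_cancel_left' add.commute diff_add_cancel)
    then show ?thesis
      by (simp add: op_minus_def)
  qed
  then show ?thesis
    by (simp add: fun_eq_iff set_eq_iff)
qed

lemma strictly_nonexpansive_iff_inj:
  assumes "firmly_nonexpansive T"
  shows "strictly_nonexpansive T \<longleftrightarrow> inj (\<lambda>x. x - T x)"
proof
  assume strict: "strictly_nonexpansive T"
  show "inj (\<lambda>x. x - T x)"
  proof (rule injI)
    fix x y assume "x - T x = y - T y"
    then have "T x - T y = x - y"
      by (simp add: algebra_simps)
    then show "x = y"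
      using strict unfolding strictly_nonexpansive_def by force
  qed
next
  assume inj: "inj (\<lambda>x. x - T x)"
  show "strictly_nonexpansive T"
    unfolding strictly_nonexpansive_def
  proof (intro allI impI)
    fix x y :: 'a assume "x \<noteq> y"
    then have "x - T x \<noteq> y - T y"
      using inj by (auto dest: injD)
    \<comment> \<open>The residual term in the firm nonexpansiveness inequality is exactly the slack
      that makes the bound on \<open>T x - T y\<close> strict.\<close>
    then have "0 < (norm ((x - T x) - (y - T y)))\<^sup>2"
      by simp
    also have "\<dots> \<le> (norm (x - y))\<^sup>2 - (norm (T x - T y))\<^sup>2"
      using assms unfolding firmly_nonexpansive_def by (metis add.commute le_diff_eq)
    finally have "(norm (T x - T y))\<^sup>2 < (norm (x - y))\<^sup>2"
      by simp
    then show "norm (T x - T y) < norm (x - y)"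
      by (rule power2_less_imp_less) simp
  qed
qed

lemma disjointly_injective_iff_inj:
  assumes "op_of T = resolvent A"
  shows "disjointly_injective A \<longleftrightarrow> inj (\<lambda>x. x - T x)"
proof -
  have A: "u \<in> A y \<longleftrightarrow> T (y + u) = y" for y u
    using assms op_of_eq_resolvent_iff by blast
  show ?thesis
  proof
    assume disj: "disjointly_injective A"
    show "inj (\<lambda>x. x - T x)"
    proof (rule injI)
      fix x y assume eq: "x - T x = y - T y"
      \<comment> \<open>Minty's parametrization of the graph: \<open>T x\<close> and
        \<open>x - T x\<close> add up to \<open>x\<close>. Equal residuals are therefore a common
        value of \<open>A\<close> at \<open>T x\<close> and \<open>T y\<close>.\<close>
      have "x - T x \<in> A (T x)" "y - T y \<in> A (T y)"
        by (simp_all add: A)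
      with eq disj have "T x = T y"
        unfolding disjointly_injective_def by (metis disjoint_iff)
      with eq show "x = y" by simp
    qed
  next
    assume inj: "inj (\<lambda>x. x - T x)"
    have "x = y" if "u \<in> A x" "u \<in> A y" for x y u
    proof -
      \<comment> \<open>Since \<open>T (x + u) = x\<close> and \<open>T (y + u) = y\<close>, both
        residuals equal \<open>u\<close>.\<close>
      have "(x + u) - T (x + u) = (y + u) - T (y + u)"
        using that by (simp add: A)
      then have "x + u = y + u"
        by (rule injD[OF inj])
      then show ?thesis by simp
    qed
    then show "disjointly_injective A"
      unfolding disjointly_injective_def by blast
  qed
qed

lemma at_most_single_valued_op_inverse_iff:
  "at_most_single_valued (op_inverse A) \<longleftrightarrow> disjointly_injective A"
  unfolding at_most_single_valued_def disjointly_injective_def Ball_def mem_op_inverse by blast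

lemma maximally_monotone_if_resolvent_total:
  assumes mono: "monotone_op A" and total: "\<And>x. resolvent A x \<noteq> {}"
  shows "maximally_monotone A"
proof -
  have "gr B \<subseteq> gr A" if B: "monotone_op B" "gr A \<subseteq> gr B" for B
  proof clarify
    fix x u assume xu: "(x, u) \<in> gr B"
    \<comment> \<open>Totality of the resolvent at \<open>x + u\<close> supplies a point of
      \<open>gr A\<close> with the same coordinate sum as \<open>(x, u)\<close>. The two differences
      are then negatives of each other, so monotonicity of \<open>B\<close> forces the points to
      coincide.\<close>
    obtain y where y: "x + u - y \<in> A y"
      using total[of "x + u"] by (auto simp: mem_resolvent)
    then have "(y, x + u - y) \<in> gr B"
      using B(2) by (metis mem_gr subsetD)
    then have "0 \<le> inner (x - y) (u - (x + u - y))"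
      using B(1) xu unfolding monotone_op_def by fastforce
    also have "\<dots> = - inner (x - y) (x - y)"
      by (simp add: inner_diff_left inner_diff_right)
    finally have "x = y"
      by (metis inner_gt_zero_iff neg_0_le_iff_le not_le right_minus_eq)
    with y show "(x, u) \<in> gr A" by simp
  qed
  with mono show ?thesis
    unfolding maximally_monotone_def by blast
qed

lemma mem_subdifferential_convex_indicator_zero [simp]:
  "u \<in> subdifferential (convex_indicator {0::'a::real_inner}) x \<longleftrightarrow> x = 0"
  using gr_subdifferential_convex_indicator_zero
  by (metis UNIV_I mem_Sigma_iff mem_gr singleton_iff)

text \<open>Only the point 0 has values, so the inner product in monotonicity vanishes and the
  resolvent sends everything to 0.\<close>

lemma maximally_monotone_subdifferential_convex_indicator_zero:
  "maximally_monotone (subdifferential (convex_indicator {0::'a::real_inner}))"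
  by (rule maximally_monotone_if_resolvent_total)
    (auto simp: monotone_op_def set_eq_iff mem_resolvent)

text \<open>Here \<open>x - y = 0\<close> characterizes \<open>y\<close> in the resolvent at
  \<open>x\<close>, so the resolvent is the identity.\<close>

lemma maximally_monotone_op_of_zero: "maximally_monotone (op_of (\<lambda>x::'a::real_inner. 0))"
  by (rule maximally_monotone_if_resolvent_total)
    (auto simp: monotone_op_def set_eq_iff mem_resolvent)

lemma op_inverse_subdifferential_convex_indicator_zero:
  "op_inverse (subdifferential (convex_indicator {0::'a::real_inner})) = op_of (\<lambda>x. 0)"
  by (simp add: fun_eq_iff set_eq_iff)

lemma disjointly_injective_subdifferential_convex_indicator_zero:
  "disjointly_injective (subdifferential (convex_indicator {0::'a::real_inner}))"
  by (auto simp: disjointly_injective_def)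

lemma not_disjointly_injective_op_of_zero:
  assumes "x \<noteq> (0::'a::real_inner)"
  shows "\<not> disjointly_injective (op_of (\<lambda>x::'a. 0::'a))"
  using assms unfolding disjointly_injective_def by (auto simp: op_of_def)

lemma firmly_nonexpansive_zero: "firmly_nonexpansive (\<lambda>x. 0)"
  by (simp add: firmly_nonexpansive_def)

lemma strictly_nonexpansive_zero: "strictly_nonexpansive (\<lambda>x. 0)"
  by (simp add: strictly_nonexpansive_def)

lemma not_strictly_nonexpansive_ident:
  assumes "x \<noteq> (0::'a::real_inner)"
  shows "\<not> strictly_nonexpansive (\<lambda>x::'a. x)"
  using assms unfolding strictly_nonexpansive_def by blast

text \<open>The witness is the zero map. A nonzero vector is required because on the zero space the
  identity is vacuously strictly nonexpansive.\<close>

lemma strictly_nonexpansive_not_self_dual: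
  assumes "x \<noteq> (0::'a::real_inner)"
  shows "\<not> dual_firmly_nonexpansive (strictly_nonexpansive :: ('a \<Rightarrow> 'a) \<Rightarrow> bool) strictly_nonexpansive"
proof
  assume "dual_firmly_nonexpansive (strictly_nonexpansive :: ('a \<Rightarrow> 'a) \<Rightarrow> bool) strictly_nonexpansive"
  then have "strictly_nonexpansive (\<lambda>x::'a. x - 0)"
    using firmly_nonexpansive_zero strictly_nonexpansive_zero
    unfolding dual_firmly_nonexpansive_def by blast
  then show False
    using not_strictly_nonexpansive_ident[OF assms] by simp
qed

lemma inj_not_self_dual:
  assumes "x \<noteq> (0::'a::real_inner)"
  shows "\<not> dual_firmly_nonexpansive (inj :: ('a \<Rightarrow> 'a) \<Rightarrow> bool) inj"
proof
  assume dual: "dual_firmly_nonexpansive (inj :: ('a \<Rightarrow> 'a) \<Rightarrow> bool) inj"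
  \<comment> \<open>For injectivity the roles are swapped: the identity is the witness, and its
    complement is the zero map.\<close>
  have "firmly_nonexpansive (\<lambda>x::'a. x)"
    by (simp add: firmly_nonexpansive_def)
  then have "inj (\<lambda>x::'a. x) = inj (\<lambda>x::'a. x - x)"
    using dual unfolding dual_firmly_nonexpansive_def by blast
  then have "inj (\<lambda>x::'a. 0::'a)"
    by simp
  then show False
    using assms by (auto dest: injD)
qed

lemma disjointly_injective_not_self_dual:
  assumes "x \<noteq> (0::'a::real_inner)"
  shows "\<not> dual_maximally_monotone (disjointly_injective :: ('a \<Rightarrow> 'a set) \<Rightarrow> bool) disjointly_injective"
  using maximally_monotone_subdifferential_convex_indicator_zero
    disjointly_injective_subdifferential_convex_indicator_zero
    not_disjointly_injective_op_of_zero[OF assms]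
  unfolding dual_maximally_monotone_def
  by (metis op_inverse_subdifferential_convex_indicator_zero)

text \<open>The witness is the zero operator: its inverse would be at most single-valued only if the
  zero operator were disjointly injective, yet it takes the value 0 at two distinct points.\<close>

lemma at_most_single_valued_not_self_dual:
  assumes "x \<noteq> (0::'a::real_inner)"
  shows "\<not> dual_maximally_monotone (at_most_single_valued :: ('a \<Rightarrow> 'a set) \<Rightarrow> bool) at_most_single_valued"
proof -
  have "at_most_single_valued (op_of (\<lambda>x::'a. 0::'a))"
    by (simp add: at_most_single_valued_def)
  then show ?thesis
    using maximally_monotone_op_of_zero not_disjointly_injective_op_of_zero[OF assms]
    unfolding dual_maximally_monotone_def
    by (metis at_most_single_valued_op_inverse_iff)
qed

theorem theorem3p3:
  shows
    "(\<forall>(T :: 'a::{real_inner, complete_space} \<Rightarrow> 'a) (A :: 'a \<Rightarrow> 'a set).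
        firmly_nonexpansive T \<and> maximally_monotone A \<longrightarrow>
          (op_of T = resolvent A \<longleftrightarrow> A = op_minus (op_inverse (op_of T)) (op_of id)) \<and>
          (op_of T = resolvent A \<longrightarrow>
             (strictly_nonexpansive T \<longleftrightarrow> disjointly_injective A) \<and>
             (disjointly_injective A \<longleftrightarrow> inj (\<lambda>x. x - T x)) \<and>
             (inj (\<lambda>x. x - T x) \<longleftrightarrow> at_most_single_valued (op_inverse A)))) \<and>
     dual_firmly_nonexpansive (strictly_nonexpansive :: ('a \<Rightarrow> 'a) \<Rightarrow> bool) inj \<and>
     dual_maximally_monotone (disjointly_injective :: ('a \<Rightarrow> 'a set) \<Rightarrow> bool) at_most_single_valued \<and>
     ((\<exists>x::'a. x \<noteq> 0) \<longrightarrow>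
        \<not> dual_firmly_nonexpansive (strictly_nonexpansive :: ('a \<Rightarrow> 'a) \<Rightarrow> bool) strictly_nonexpansive \<and>
        \<not> dual_firmly_nonexpansive (inj :: ('a \<Rightarrow> 'a) \<Rightarrow> bool) inj \<and>
        \<not> dual_maximally_monotone (disjointly_injective :: ('a \<Rightarrow> 'a set) \<Rightarrow> bool) disjointly_injective \<and>
        \<not> dual_maximally_monotone (at_most_single_valued :: ('a \<Rightarrow> 'a set) \<Rightarrow> bool) at_most_single_valued) \<and>
     (let T = (\<lambda>x::'a. 0::'a) in
        firmly_nonexpansive T \<and> strictly_nonexpansive T \<and> (\<lambda>x. x - T x) = id \<and>
        ((\<exists>x::'a. x \<noteq> 0) \<longrightarrow> \<not> strictly_nonexpansive (\<lambda>x. x - T x))) \<and>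
     (let A = subdifferential (convex_indicator {0::'a}) in
        maximally_monotone A \<and> op_of (\<lambda>x. 0) = resolvent A \<and>
        disjointly_injective A \<and> op_inverse A = op_of (\<lambda>x. 0) \<and>
        ((\<exists>x::'a. x \<noteq> 0) \<longrightarrow> \<not> disjointly_injective (op_inverse A)))"
proof -
  let ?D = "subdifferential (convex_indicator {0::'a})"
  have equiv: "op_of T = resolvent A \<longleftrightarrow> A = op_minus (op_inverse (op_of T)) (op_of id)"
    for T :: "'a \<Rightarrow> 'a" and A
    by (simp only: op_of_eq_resolvent_iff eq_op_inverse_minus_id_iff)
  have chain: "(strictly_nonexpansive T \<longleftrightarrow> disjointly_injective A) \<and>
      (disjointly_injective A \<longleftrightarrow> inj (\<lambda>x. x - T x)) \<and>
      (inj (\<lambda>x. x - T x) \<longleftrightarrow> at_most_single_valued (op_inverse A))"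
    if "firmly_nonexpansive T" "op_of T = resolvent A" for T :: "'a \<Rightarrow> 'a" and A
    using strictly_nonexpansive_iff_inj[OF that(1)] disjointly_injective_iff_inj[OF that(2)]
    by (simp add: at_most_single_valued_op_inverse_iff)
  have dual: "dual_firmly_nonexpansive (strictly_nonexpansive :: ('a \<Rightarrow> 'a) \<Rightarrow> bool) inj"
    "dual_maximally_monotone (disjointly_injective :: ('a \<Rightarrow> 'a set) \<Rightarrow> bool) at_most_single_valued"
    by (simp_all add: dual_firmly_nonexpansive_def strictly_nonexpansive_iff_inj
        dual_maximally_monotone_def at_most_single_valued_op_inverse_iff)
  \<comment> \<open>The subtraction of 0 is left unsimplified to match the complement of the zero
    map after the \<open>let\<close> is unfolded.\<close>
  have zero: "(\<lambda>x::'a. x - 0) = id" "\<And>x::'a. x \<noteq> 0 \<Longrightarrow> \<not> strictly_nonexpansive (\<lambda>x::'a. x - 0)"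
    using not_strictly_nonexpansive_ident by (simp_all add: id_def)
  have resolvent_D: "op_of (\<lambda>x. 0) = resolvent ?D"
    by (simp add: fun_eq_iff set_eq_iff mem_resolvent)
  note not_self_dual = strictly_nonexpansive_not_self_dual inj_not_self_dual
    disjointly_injective_not_self_dual at_most_single_valued_not_self_dual
  show ?thesis
    unfolding Let_def op_inverse_subdifferential_convex_indicator_zero
    by (intro conjI allI impI equiv chain dual zero(1) resolvent_D refl
        firmly_nonexpansive_zero strictly_nonexpansive_zero
        maximally_monotone_subdifferential_convex_indicator_zero
        disjointly_injective_subdifferential_convex_indicator_zero;
      \<comment> \<open>What remains are the premises of \<open>chain\<close> and the claims for
        nontrivial spaces; for the latter the nonzero vector is extracted first.\<close>
      (elim exE conjE)?; (assumption | erule not_self_dual zero(2) not_disjointly_injective_op_of_zero))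
qed

end
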